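(* Let $X$ be a bounded geometry metric space. If $X$ has property $ULA_\mu$, then $X$ admits a coarse embedding into a Hilbert space.
   Context: A metric space $X$ has bounded geometry if for all $R>0$ there is $N_R\in\mathbb{N}$ such that every closed ball of radius $R$ in $X$ has at most $N_R$ points. For $E\subseteq X$ and $R>0$: $N_R(E)=\{y\in X: d(y,E)\le R\}$ and $\partial_RE=N_R(E)\setminus E$. $ULA_\mu$: for all $R,\epsilon>0$ there exists $S>0$ such that for all probability measures $\mu$ on $X$ there exists a finite set $E\subseteq X$ with $\mathrm{diam}(E)\le S$ and $\mu(\partial_RE)<\epsilon\,\mu(E)$. A map $f:X\to Y$ of metric spaces is a coarse embedding if there exist non-decreasing functions $\rho_+,\rho_-:[0,\infty)\to[0,\infty)$ with $\rho_-(t)\to\infty$ as $t\to\infty$ and $\rho_-(d_X(x_1,x_2))\le d_Y(f(x_1),f(x_2))\le\rho_+(d_X(x_1,x_2))$ for all $x_1,x_2\in X$. *)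

theory Defs
  imports "HOL-Analysis.Analysis" "HOL-Probability.Probability_Measure"
begin

section \<open>Coarse notions for a subset of a metric space\<close>

text \<open>A metric space is represented by a set \<open>X\<close> in a type of class \<open>metric_space\<close>, with the
  induced metric; \<open>X = UNIV\<close> and \<open>X = {}\<close> are allowed.\<close>

definition bounded_geometry :: "'a::metric_space set \<Rightarrow> bool" where
  "bounded_geometry X \<longleftrightarrow>
     (\<forall>R>0. \<exists>N::nat. \<forall>x\<in>X. finite (X \<inter> cball x R) \<and> card (X \<inter> cball x R) \<le> N)"

text \<open>The guard \<open>E \<noteq> {}\<close> implements \<open>d(y, {}) = \<infinity>\<close>; \<open>infdist y {}\<close> is \<open>0\<close>.\<close>

definition nbhd :: "'a::metric_space set \<Rightarrow> real \<Rightarrow> 'a set \<Rightarrow> 'a set" where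
  "nbhd X R E = {y\<in>X. E \<noteq> {} \<and> infdist y E \<le> R}"

definition boundary :: "'a::metric_space set \<Rightarrow> real \<Rightarrow> 'a set \<Rightarrow> 'a set" where
  "boundary X R E = nbhd X R E - E"

text \<open>The measures are the Borel probability measures on \<open>X\<close>. If \<open>X\<close> has bounded geometry, then
  it is countable and discrete, and every subset of \<open>X\<close> is measurable.\<close>

definition ULA_mu :: "'a::metric_space set \<Rightarrow> bool" where
  "ULA_mu X \<longleftrightarrow>
     (\<forall>R>0. \<forall>\<epsilon>>0. \<exists>S>0. \<forall>\<mu>. prob_space \<mu> \<and> sets \<mu> = sets (restrict_space borel X) \<longrightarrow>
        (\<exists>E\<subseteq>X. finite E \<and> diameter E \<le> S \<and>
           measure \<mu> (boundary X R E) < \<epsilon> * measure \<mu> E))"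

definition coarse_embedding :: "'a::metric_space set \<Rightarrow> ('a \<Rightarrow> 'b::metric_space) \<Rightarrow> bool" where
  "coarse_embedding X f \<longleftrightarrow>
     (\<exists>\<rho>\<^sub>p \<rho>\<^sub>m :: real \<Rightarrow> real.
        mono_on {0..} \<rho>\<^sub>p \<and> mono_on {0..} \<rho>\<^sub>m \<and>
        \<rho>\<^sub>p ` {0..} \<subseteq> {0..} \<and> \<rho>\<^sub>m ` {0..} \<subseteq> {0..} \<and>
        filterlim \<rho>\<^sub>m at_top at_top \<and>
        (\<forall>x\<in>X. \<forall>y\<in>X. \<rho>\<^sub>m (dist x y) \<le> dist (f x) (f y) \<and>
                        dist (f x) (f y) \<le> \<rho>\<^sub>p (dist x y)))"


section \<open>The Hilbert space of square-summable real sequences\<close>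

text \<open>HOL cannot quantify existentially over types, so a Hilbert space as the target of a coarse
  embedding is given by this type. It is an instance of \<open>real_inner\<close> and \<open>complete_space\<close>, and
  \<open>coarse_embedding_into_ell2\<close> below shows that, for countable (in particular bounded geometry)
  spaces, restricting to this Hilbert space loses nothing.\<close>

typedef ell2 = "{x :: nat \<Rightarrow> real. summable (\<lambda>n. (x n)\<^sup>2)}"
  morphisms coord Abs_ell2
  by (rule exI[of _ "\<lambda>_. 0"]) simp

lemma summable_coord: "summable (\<lambda>n. (coord x n)\<^sup>2)"
  using coord[of x] by simp

lemma coord_Abs: "summable (\<lambda>n. (x n)\<^sup>2) \<Longrightarrow> coord (Abs_ell2 x) = x"
  by (simp add: Abs_ell2_inverse)

lemma ell2_eqI: "(\<And>n. coord x n = coord y n) \<Longrightarrow> x = y"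
  by (metis coord_inject ext)

lemma summable_sq_add:
  fixes x y :: "nat \<Rightarrow> real"
  assumes "summable (\<lambda>n. (x n)\<^sup>2)" "summable (\<lambda>n. (y n)\<^sup>2)"
  shows "summable (\<lambda>n. (x n + y n)\<^sup>2)"
proof (rule summable_comparison_test'[where N = 0])
  show "summable (\<lambda>n. 2 * (x n)\<^sup>2 + 2 * (y n)\<^sup>2)"
    by (intro summable_add summable_mult assms)
  fix n
  have "0 \<le> (x n - y n)\<^sup>2" by simp
  then have "(x n + y n)\<^sup>2 \<le> 2 * (x n)\<^sup>2 + 2 * (y n)\<^sup>2"
    by (simp add: power2_eq_square algebra_simps)
  then show "norm ((x n + y n)\<^sup>2) \<le> 2 * (x n)\<^sup>2 + 2 * (y n)\<^sup>2"
    by simp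
qed

lemma summable_mult_coord: "summable (\<lambda>n. coord x n * coord y n)"
proof (rule summable_comparison_test'[where N = 0])
  show "summable (\<lambda>n. (coord x n)\<^sup>2 + (coord y n)\<^sup>2)"
    by (intro summable_add summable_coord)
  fix n
  have "2 * \<bar>a * b\<bar> \<le> a\<^sup>2 + b\<^sup>2" for a b :: real
    using sum_squares_bound[of "\<bar>a\<bar>" "\<bar>b\<bar>"] by (simp add: abs_mult)
  from this[of "coord x n" "coord y n"]
  show "norm (coord x n * coord y n) \<le> (coord x n)\<^sup>2 + (coord y n)\<^sup>2"
    unfolding real_norm_def by linarith
qed

instantiation ell2 :: real_inner
begin

definition "0 = Abs_ell2 (\<lambda>n. 0)"
definition "x + y = Abs_ell2 (\<lambda>n. coord x n + coord y n)"
definition "- x = Abs_ell2 (\<lambda>n. - coord x n)"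
definition "x - y = Abs_ell2 (\<lambda>n. coord x n - coord y n)"
definition "r *\<^sub>R x = Abs_ell2 (\<lambda>n. r * coord x n)"
definition "inner x y = (\<Sum>n. coord x n * coord y n)"
definition "norm (x::ell2) = sqrt (inner x x)"
definition "dist (x::ell2) y = norm (x - y)"
definition "sgn (x::ell2) = inverse (norm x) *\<^sub>R x"
definition "(uniformity :: (ell2 \<times> ell2) filter) = (INF e\<in>{0<..}. principal {(x, y). dist x y < e})"
definition "open (U :: ell2 set) \<longleftrightarrow> (\<forall>x\<in>U. eventually (\<lambda>(x', y). x' = x \<longrightarrow> y \<in> U) uniformity)"

lemma coord_zero: "coord 0 n = 0"
  unfolding zero_ell2_def by (subst coord_Abs) auto

lemma coord_add: "coord (x + y) n = coord x n + coord y n"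
  unfolding plus_ell2_def by (subst coord_Abs) (auto intro: summable_sq_add summable_coord)

lemma coord_uminus: "coord (- x) n = - coord x n"
  unfolding uminus_ell2_def by (subst coord_Abs) (auto intro: summable_coord)

lemma coord_minus: "coord (x - y) n = coord x n - coord y n"
  unfolding minus_ell2_def
  using summable_sq_add[OF summable_coord summable_coord, of x "- y"]
  by (subst coord_Abs) (auto simp: coord_uminus)

lemma coord_scaleR: "coord (r *\<^sub>R x) n = r * coord x n"
  unfolding scaleR_ell2_def
  by (subst coord_Abs) (auto intro: summable_mult summable_coord simp: power_mult_distrib)

instance
proof
  fix x y z :: ell2 and a b :: real
  show "x + y + z = x + (y + z)" "x + y = y + x" "0 + x = x" "- x + x = 0" "x - y = x + - y"
    "a *\<^sub>R (x + y) = a *\<^sub>R x + a *\<^sub>R y" "(a + b) *\<^sub>R x = a *\<^sub>R x + b *\<^sub>R x"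
    "a *\<^sub>R b *\<^sub>R x = (a * b) *\<^sub>R x" "1 *\<^sub>R x = x"
    by (auto intro!: ell2_eqI
        simp: coord_zero coord_add coord_uminus coord_minus coord_scaleR algebra_simps)
  show "dist x y = norm (x - y)" by (rule dist_ell2_def)
  show "sgn x = inverse (norm x) *\<^sub>R x" by (rule sgn_ell2_def)
  show "(uniformity :: (ell2 \<times> ell2) filter) = (INF e\<in>{0<..}. principal {(x, y). dist x y < e})"
    by (rule uniformity_ell2_def)
  show "open U \<longleftrightarrow> (\<forall>x\<in>U. \<forall>\<^sub>F (x', y) in uniformity. x' = x \<longrightarrow> y \<in> U)" for U :: "ell2 set"
    by (rule open_ell2_def)
  show "inner x y = inner y x" by (simp add: inner_ell2_def mult.commute)
  show "inner (x + y) z = inner x z + inner y z"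
    unfolding inner_ell2_def coord_add distrib_right
    by (intro suminf_add[symmetric] summable_mult_coord)
  show "inner (a *\<^sub>R x) y = a * inner x y"
    unfolding inner_ell2_def coord_scaleR mult.assoc
    by (intro suminf_mult summable_mult_coord)
  show "0 \<le> inner x x"
    unfolding inner_ell2_def by (intro suminf_nonneg summable_mult_coord) simp
  show "inner x x = 0 \<longleftrightarrow> x = 0"
    unfolding inner_ell2_def
    by (subst suminf_eq_zero_iff) (auto intro: summable_mult_coord ell2_eqI simp: coord_zero)
  show "norm x = sqrt (inner x x)" by (rule norm_ell2_def)
qed

end

lemma norm_ell2_power2: "(norm (x::ell2))\<^sup>2 = (\<Sum>n. (coord x n)\<^sup>2)"
  unfolding power2_norm_eq_inner inner_ell2_def by (simp add: power2_eq_square)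

lemma sum_coord_le_norm: "(\<Sum>n<k. (coord x n)\<^sup>2) \<le> (norm x)\<^sup>2"
  unfolding norm_ell2_power2 by (intro sum_le_suminf summable_coord) auto

lemma abs_coord_le_norm: "\<bar>coord x n\<bar> \<le> norm x"
proof -
  have "(coord x n)\<^sup>2 \<le> (\<Sum>i<Suc n. (coord x i)\<^sup>2)"
    by (simp add: sum_nonneg)
  also have "\<dots> \<le> (norm x)\<^sup>2" by (rule sum_coord_le_norm)
  finally show ?thesis using abs_le_square_iff[of "coord x n" "norm x"] by simp
qed

instance ell2 :: complete_space
proof
  fix X :: "nat \<Rightarrow> ell2"
  assume C: "Cauchy X"
  have "Cauchy (\<lambda>m. coord (X m) n)" for n
    unfolding Cauchy_def
  proof (intro allI impI)
    fix e :: real assume "e > 0"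
    with C obtain M where M: "dist (X i) (X j) < e" if "i \<ge> M" "j \<ge> M" for i j
      unfolding Cauchy_def by meson
    have "dist (coord (X i) n) (coord (X j) n) < e" if "i \<ge> M" "j \<ge> M" for i j
      using abs_coord_le_norm[of "X i - X j" n] M[OF that]
      by (simp add: coord_minus dist_norm)
    then show "\<exists>M. \<forall>m\<ge>M. \<forall>k\<ge>M. dist (coord (X m) n) (coord (X k) n) < e" by blast
  qed
  then have "\<forall>n. \<exists>l. (\<lambda>m. coord (X m) n) \<longlonglongrightarrow> l"
    by (simp add: Cauchy_convergent convergent_def[symmetric])
  then obtain y where y: "\<And>n. (\<lambda>m. coord (X m) n) \<longlonglongrightarrow> y n"
    by metis
  have part: "\<exists>M. \<forall>m\<ge>M. \<forall>k. (\<Sum>n<k. (y n - coord (X m) n)\<^sup>2) \<le> e\<^sup>2" if "e > 0" for e :: real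
  proof -
    from C that obtain M where M: "dist (X i) (X j) < e" if "i \<ge> M" "j \<ge> M" for i j
      unfolding Cauchy_def by meson
    have "(\<Sum>n<k. (y n - coord (X m) n)\<^sup>2) \<le> e\<^sup>2" if "m \<ge> M" for m k
    proof (rule tendsto_upperbound)
      show "(\<lambda>i. \<Sum>n<k. (coord (X i) n - coord (X m) n)\<^sup>2) \<longlonglongrightarrow> (\<Sum>n<k. (y n - coord (X m) n)\<^sup>2)"
        by (intro tendsto_intros y)
      have "(\<Sum>n<k. (coord (X i) n - coord (X m) n)\<^sup>2) \<le> e\<^sup>2" if "i \<ge> M" for i
        using sum_coord_le_norm[of "X i - X m" k] M[OF \<open>i \<ge> M\<close> \<open>m \<ge> M\<close>]
          power_mono[of "norm (X i - X m)" e 2]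
        by (simp add: coord_minus dist_norm)
      then show "\<forall>\<^sub>F i in sequentially. (\<Sum>n<k. (coord (X i) n - coord (X m) n)\<^sup>2) \<le> e\<^sup>2"
        unfolding eventually_sequentially by blast
    qed simp
    then show ?thesis by blast
  qed
  have summ: "summable (\<lambda>n. (y n - coord (X m) n)\<^sup>2)"
    if "\<forall>k. (\<Sum>n<k. (y n - coord (X m) n)\<^sup>2) \<le> e" for m e
    by (rule bounded_imp_summable[where B = e])
      (use that in \<open>auto simp del: sum.lessThan_Suc simp flip: lessThan_Suc_atMost\<close>)
  obtain m where "\<forall>k. (\<Sum>n<k. (y n - coord (X m) n)\<^sup>2) \<le> 1\<^sup>2"
    using part[of 1] by auto
  then have "summable (\<lambda>n. ((y n - coord (X m) n) + coord (X m) n)\<^sup>2)"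
    by (intro summable_sq_add summable_coord summ)
  then have Y: "coord (Abs_ell2 y) = y"
    by (simp add: coord_Abs)
  have "X \<longlonglongrightarrow> Abs_ell2 y"
  proof (rule metric_LIMSEQ_I)
    fix e :: real assume "e > 0"
    then obtain M where M: "(\<Sum>n<k. (y n - coord (X m) n)\<^sup>2) \<le> (e/2)\<^sup>2" if "m \<ge> M" for m k
      using part[of "e/2"] by auto
    have "dist (X m) (Abs_ell2 y) < e" if "m \<ge> M" for m
    proof -
      have "(norm (Abs_ell2 y - X m))\<^sup>2 \<le> (e/2)\<^sup>2"
        unfolding norm_ell2_power2 coord_minus Y
        using M[OF that] by (intro suminf_le_const summ) auto
      then have "norm (Abs_ell2 y - X m) \<le> e/2"
        by (rule power2_le_imp_le) (use \<open>e > 0\<close> in simp)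
      then show ?thesis
        using \<open>e > 0\<close> by (simp add: dist_norm norm_minus_commute)
    qed
    then show "\<exists>M. \<forall>m\<ge>M. dist (X m) (Abs_ell2 y) < e" by blast
  qed
  then show "convergent X" by (auto simp: convergent_def)
qed


section \<open>Universality of \<open>ell2\<close> for countable spaces\<close>

lemma bounded_geometry_countable:
  assumes "bounded_geometry X"
  shows "countable X"
proof (cases "X = {}")
  case False
  then obtain a where a: "a \<in> X" by blast
  have "X \<subseteq> (\<Union>n::nat. X \<inter> cball a (real (Suc n)))"
  proof
    fix x assume "x \<in> X"
    moreover obtain n where "dist a x \<le> real n" using real_arch_simple by blast
    ultimately show "x \<in> (\<Union>n::nat. X \<inter> cball a (real (Suc n)))"
      by (auto intro!: exI[of _ n])
  qed
  moreover have "finite (X \<inter> cball a (real (Suc n)))" for n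
    using assms a unfolding bounded_geometry_def by (metis of_nat_0_less_iff zero_less_Suc)
  ultimately show ?thesis
    by (elim countable_subset) (intro countable_UN countableI_type countable_finite)
qed simp

text \<open>Gram-Schmidt; \<open>sgn 0 = 0\<close>, so linearly dependent vectors contribute \<open>0\<close>.\<close>

fun gs :: "(nat \<Rightarrow> 'h::real_inner) \<Rightarrow> nat \<Rightarrow> 'h" where
  "gs v n = sgn (v n - (\<Sum>k<n. (v n \<bullet> gs v k) *\<^sub>R gs v k))"

declare gs.simps [simp del]

lemma gs_idem: "(a \<bullet> gs v i) * (gs v i \<bullet> gs v i) = a \<bullet> gs v i"
proof (cases "gs v i = 0")
  case False
  then have "norm (gs v i) = 1"
    unfolding gs.simps[of v i] by (simp only: norm_sgn sgn_zero_iff if_False)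
  then show ?thesis by (simp add: dot_square_norm)
qed simp

lemma gs_orthogonal: "i < j \<Longrightarrow> gs v i \<bullet> gs v j = 0"
proof (induction j arbitrary: i rule: less_induct)
  case (less j)
  have orth: "gs v k \<bullet> gs v l = 0" if "k < j" "l < j" "k \<noteq> l" for k l
    using less.IH[of k l] less.IH[of l k] that by (cases k l rule: linorder_cases) (auto simp: inner_commute)
  let ?r = "v j - (\<Sum>k<j. (v j \<bullet> gs v k) *\<^sub>R gs v k)"
  have "gs v i \<bullet> (\<Sum>k<j. (v j \<bullet> gs v k) *\<^sub>R gs v k)
      = (\<Sum>k<j. if k = i then v j \<bullet> gs v i else 0)"
    unfolding inner_sum_right
    by (rule sum.cong) (use orth less.prems gs_idem[of "v j" v i] in \<open>auto simp: mult.commute\<close>)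
  also have "\<dots> = v j \<bullet> gs v i" using less.prems by simp
  finally have "gs v i \<bullet> ?r = 0" by (simp add: inner_diff_right inner_commute)
  then show ?case unfolding gs.simps[of v j] sgn_div_norm inner_scaleR_right by simp
qed

lemma gs_expand:
  obtains c where "v n = (\<Sum>k\<le>n. c k *\<^sub>R gs v k)"
proof -
  let ?r = "v n - (\<Sum>k<n. (v n \<bullet> gs v k) *\<^sub>R gs v k)"
  have "v n = (\<Sum>k<n. (v n \<bullet> gs v k) *\<^sub>R gs v k) + norm ?r *\<^sub>R gs v n"
    by (cases "?r = 0") (simp_all add: gs.simps[of v n] sgn_div_norm)
  also have "\<dots> = (\<Sum>k\<le>n. (if k < n then v n \<bullet> gs v k else norm ?r) *\<^sub>R gs v k)"
    unfolding lessThan_Suc_atMost[symmetric] by simp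
  finally show ?thesis by (rule that)
qed

lemma gs_inner_expand:
  assumes "v n = (\<Sum>k\<le>n. c k *\<^sub>R gs v k)"
  shows "v n \<bullet> gs v l = (if l \<le> n then c l * (gs v l \<bullet> gs v l) else 0)"
proof -
  have "gs v k \<bullet> gs v l = 0" if "k \<noteq> l" for k l
    using gs_orthogonal[of k l v] gs_orthogonal[of l k v] that
    by (cases k l rule: linorder_cases) (auto simp: inner_commute)
  then have "v n \<bullet> gs v l = (\<Sum>k\<le>n. if k = l then c l * (gs v l \<bullet> gs v l) else 0)"
    unfolding assms inner_sum_left by (intro sum.cong) auto
  then show ?thesis by simp
qed

lemma exists_ell2_same_inner:
  fixes v :: "nat \<Rightarrow> 'h::real_inner"
  shows "\<exists>w :: nat \<Rightarrow> ell2. \<forall>m n. w m \<bullet> w n = v m \<bullet> v n"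
proof -
  define w where "w n = Abs_ell2 (\<lambda>l. v n \<bullet> gs v l)" for n
  have z: "v n \<bullet> gs v l = 0" if "l \<notin> {..n}" for n l
  proof -
    obtain c where "v n = (\<Sum>k\<le>n. c k *\<^sub>R gs v k)" by (rule gs_expand)
    from gs_inner_expand[OF this, of l] that show ?thesis by simp
  qed
  have cw: "coord (w n) = (\<lambda>l. v n \<bullet> gs v l)" for n
    unfolding w_def by (rule coord_Abs, rule summable_finite[of "{..n}"]) (auto simp: z)
  have "w m \<bullet> w n = v m \<bullet> v n" for m n
  proof -
    obtain c where c: "v n = (\<Sum>k\<le>n. c k *\<^sub>R gs v k)" by (rule gs_expand)
    have "w m \<bullet> w n = (\<Sum>l\<le>n. (v m \<bullet> gs v l) * (v n \<bullet> gs v l))"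
      unfolding inner_ell2_def cw by (rule suminf_finite) (auto simp: z)
    also have "\<dots> = (\<Sum>l\<le>n. c l * (v m \<bullet> gs v l))"
    proof (rule sum.cong)
      fix l assume "l \<in> {..n}"
      then have "v n \<bullet> gs v l = c l * (gs v l \<bullet> gs v l)"
        using gs_inner_expand[OF c, of l] by simp
      then show "(v m \<bullet> gs v l) * (v n \<bullet> gs v l) = c l * (v m \<bullet> gs v l)"
        using gs_idem[of "v m" v l] by (simp add: mult_ac)
    qed simp
    also have "\<dots> = v m \<bullet> v n" by (subst c) (simp add: inner_sum_right)
    finally show ?thesis .
  qed
  then show ?thesis by blast
qed

theorem coarse_embedding_into_ell2:
  fixes X :: "'a::metric_space set" and f :: "'a \<Rightarrow> 'h::real_inner"
  assumes "countable X" and f: "coarse_embedding X f"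
  shows "\<exists>g :: 'a \<Rightarrow> ell2. coarse_embedding X g"
proof -
  obtain w :: "nat \<Rightarrow> ell2"
    where w: "w m \<bullet> w n = f (from_nat_into X m) \<bullet> f (from_nat_into X n)" for m n
    using exists_ell2_same_inner[of "\<lambda>n. f (from_nat_into X n)"] by auto
  define g where "g x = w (to_nat_on X x)" for x
  have inner: "g x \<bullet> g y = f x \<bullet> f y" if "x \<in> X" "y \<in> X" for x y
    using that assms(1) by (simp add: g_def w)
  have "dist (g x) (g y) = dist (f x) (f y)" if "x \<in> X" "y \<in> X" for x y
    unfolding dist_norm norm_eq_sqrt_inner using that
    by (simp add: inner_diff_left inner_diff_right inner)
  then show ?thesis using f unfolding coarse_embedding_def by (intro exI[of _ g]) simp
qed

end

theory Submission
  imports Defs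
begin

text \<open>Applied repeatedly to the normalised restrictions of a finite measure to what is left,
  \<open>ULA_mu\<close> cuts a finite set \<open>F\<close> into pieces of diameter at most \<open>S\<close> such that points at distance
  at most \<open>R\<close> lie in the same piece, apart from a set of small relative measure. Given weights on
  the pairs at distance at most \<open>R\<close>, take as measure the weighted degree: some partition separates
  only a small weighted proportion of these pairs. By a minimax argument, a suitable random partition
  then separates each such pair with small probability, uniformly in \<open>F\<close>. The separation probability
  is a kernel of negative type, small for distances at most \<open>R\<close> and equal to \<open>1\<close> for distances above
  \<open>S\<close>; summing such kernels over scales embeds the finite subsets of \<open>X\<close> in \<open>ell2\<close> with uniform
  control, and a compactness argument passes to \<open>X\<close>.\<close>

section \<open>Random partitions\<close>

text \<open>\<open>ULA_mu\<close> is applied to the probability measure on \<open>F\<close>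
  proportional to \<open>w\<close>. Points outside \<open>F\<close> have no mass, so the set
  obtained may be replaced by its trace on \<open>F\<close>. The bound \<open>S\<close> is fixed
  before \<open>F\<close> and \<open>w\<close>; all later uniformity rests on this.\<close>

lemma ULA_mu_finite:
  fixes X :: "'a::metric_space set" and R \<epsilon> :: real
  assumes "ULA_mu X" "R > 0" "\<epsilon> > 0"
  obtains S where "S > 0"
    "\<And>F w. \<lbrakk>finite F; F \<subseteq> X; \<And>x. 0 \<le> w x; 0 < sum w F\<rbrakk> \<Longrightarrow>
       \<exists>E\<subseteq>F. E \<noteq> {} \<and> (\<forall>x\<in>E. \<forall>y\<in>E. dist x y \<le> S) \<and>
         sum w {y\<in>F - E. \<exists>x\<in>E. dist x y \<le> R} \<le> \<epsilon> * sum w E"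
proof -
  obtain S where S: "S > 0" and ula: "\<And>\<mu>. \<lbrakk>prob_space \<mu>; sets \<mu> = sets (restrict_space borel X)\<rbrakk> \<Longrightarrow>
        \<exists>E\<subseteq>X. finite E \<and> diameter E \<le> S \<and>
           measure \<mu> (boundary X R E) < \<epsilon> * measure \<mu> E"
    using assms(1)[unfolded ULA_mu_def, rule_format, OF assms(2,3)] by blast
  show thesis
  proof (rule that[OF S])
    fix F and w :: "'a \<Rightarrow> real"
    assume F: "finite F" "F \<subseteq> X" and w: "\<And>x. 0 \<le> w x" and pos: "0 < sum w F"
    define W where "W = sum w F"
    define P where "P = point_measure F (\<lambda>x. ennreal (w x / W))"
    \<comment> \<open>\<open>P\<close> lives on the subsets of \<open>F\<close>; pushing it forward
      along the identity gives it the Borel sets of \<open>X\<close> that \<open>ULA_mu\<close> asks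
      for.\<close>
    define \<mu> where "\<mu> = distr P (restrict_space borel X) (\<lambda>x. x)"
    have id: "(\<lambda>x. x) \<in> measurable P (restrict_space borel X)"
      unfolding P_def measurable_point_measure_eq1 using F by (auto simp: space_restrict_space)
    have \<mu>: "measure \<mu> A = sum w (F \<inter> A) / W" if "A \<in> sets (restrict_space borel X)" for A
    proof -
      have "measure \<mu> A = measure P (F \<inter> A)"
        unfolding \<mu>_def using that by (subst measure_distr[OF id]) (auto simp: P_def space_point_measure Int_commute)
      also have "\<dots> = (\<Sum>x\<in>F \<inter> A. w x / W)"
        unfolding P_def using w pos by (subst measure_point_measure_finite_if[OF F(1)]) (auto simp: W_def)
      finally show ?thesis by (simp add: sum_divide_distrib)
    qed
    have "emeasure P F = (\<Sum>x\<in>F. ennreal (w x / W))"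
      unfolding P_def using F by (subst emeasure_point_measure_finite) auto
    also have "\<dots> = ennreal (\<Sum>x\<in>F. w x / W)"
      using w pos by (intro sum_ennreal) (auto simp: W_def)
    also have "\<dots> = 1" using pos by (simp add: sum_divide_distrib[symmetric] W_def)
    finally have "prob_space P" by (intro prob_spaceI) (simp add: P_def space_point_measure)
    then have "prob_space \<mu>" unfolding \<mu>_def by (rule prob_space.prob_space_distr[OF _ id])
    then obtain E where E: "E \<subseteq> X" "finite E" "diameter E \<le> S"
      and lt: "measure \<mu> (boundary X R E) < \<epsilon> * measure \<mu> E"
      using ula[of \<mu>] by (auto simp: \<mu>_def)
    have sE: "E \<in> sets (restrict_space borel X)"
      using E by (auto simp: sets_restrict_space intro!: image_eqI[of _ _ E] borel_closed finite_imp_closed)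
    have "E \<noteq> {}" using lt by (auto simp: boundary_def nbhd_def)
    then have "boundary X R E = X \<inter> ({y. infdist y E \<le> R} - E)"
      by (auto simp: boundary_def nbhd_def)
    moreover have "{y. infdist y E \<le> R} - E \<in> sets borel"
      using E(2) by (intro sets.Diff borel_closed closed_Collect_le continuous_intros finite_imp_closed)
    ultimately have sB: "boundary X R E \<in> sets (restrict_space borel X)"
      by (auto simp: sets_restrict_space)
    have lt': "sum w (F \<inter> boundary X R E) < \<epsilon> * sum w (F \<inter> E)"
      using lt pos by (simp add: \<mu>[OF sE] \<mu>[OF sB] field_simps W_def)
    \<comment> \<open>A point of \<open>F\<close> outside \<open>E\<close> and within
      \<open>R\<close> of \<open>F \<inter> E\<close> is within \<open>R\<close> of
      \<open>E\<close>, so the trace has no larger boundary in \<open>F\<close>.\<close>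
    have "sum w {y\<in>F - (F \<inter> E). \<exists>x\<in>F \<inter> E. dist x y \<le> R} \<le> sum w (F \<inter> boundary X R E)"
    proof (rule sum_mono2)
      show "{y\<in>F - (F \<inter> E). \<exists>x\<in>F \<inter> E. dist x y \<le> R} \<subseteq> F \<inter> boundary X R E"
        using F(2) \<open>E \<noteq> {}\<close>
        by (auto simp: boundary_def nbhd_def dist_commute intro: infdist_le2)
    qed (use F w in auto)
    then have "sum w {y\<in>F - (F \<inter> E). \<exists>x\<in>F \<inter> E. dist x y \<le> R} \<le> \<epsilon> * sum w (F \<inter> E)"
      using lt' by simp
    \<comment> \<open>Strictness of the bound excludes an empty trace, so every cut makes
      progress.\<close>
    moreover have "F \<inter> E \<noteq> {}"
    proof
      assume "F \<inter> E = {}"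
      then have "sum w (F \<inter> boundary X R E) < 0" using lt' by simp
      moreover have "0 \<le> sum w (F \<inter> boundary X R E)" by (intro sum_nonneg w)
      ultimately show False by simp
    qed
    moreover have "dist x y \<le> S" if "x \<in> E" "y \<in> E" for x y
      using diameter_bounded_bound[OF finite_imp_bounded[OF E(2)] that] E(3) by simp
    ultimately show "\<exists>E\<subseteq>F. E \<noteq> {} \<and> (\<forall>x\<in>E. \<forall>y\<in>E. dist x y \<le> S) \<and>
         sum w {y\<in>F - E. \<exists>x\<in>E. dist x y \<le> R} \<le> \<epsilon> * sum w E"
      by (intro exI[of _ "F \<inter> E"]) auto
  qed
qed

text \<open>Induction by cutting: \<open>E\<close> becomes a piece, the layer \<open>D\<close>
  within \<open>R\<close> of it is discarded into \<open>B\<close>, and the induction continues on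
  the rest \<open>G\<close>. Points of \<open>E\<close> and \<open>G\<close> are more than
  \<open>R\<close> apart, so a separated close pair has a discarded point. Each layer is charged to
  its own \<open>E\<close>, and these sets are disjoint. Labels are subsets of the current set
  containing the labelled point, which keeps labels from different stages distinct.\<close>

lemma sparse_partition:
  fixes w :: "'a::metric_space \<Rightarrow> real"
  assumes step: "\<And>F. \<lbrakk>finite F; F \<subseteq> X; 0 < sum w F\<rbrakk> \<Longrightarrow>
       \<exists>E\<subseteq>F. E \<noteq> {} \<and> (\<forall>x\<in>E. \<forall>y\<in>E. dist x y \<le> S) \<and>
         sum w {y\<in>F - E. \<exists>x\<in>E. dist x y \<le> R} \<le> \<epsilon> * sum w E"
    and w: "\<And>x. 0 \<le> w x" and "0 \<le> S" "0 \<le> \<epsilon>"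
    and "finite F" "F \<subseteq> X"
  shows "\<exists>(L :: 'a \<Rightarrow> 'a set) B. B \<subseteq> F \<and> sum w B \<le> \<epsilon> * sum w F \<and>
    (\<forall>x\<in>F. x \<in> L x \<and> L x \<subseteq> F) \<and>
    (\<forall>x\<in>F. \<forall>y\<in>F. L x = L y \<longrightarrow> dist x y \<le> S) \<and>
    (\<forall>x\<in>F - B. \<forall>y\<in>F - B. dist x y \<le> R \<longrightarrow> L x = L y)"
  using assms(5,6)
proof (induction F rule: finite_psubset_induct)
  case (psubset F)
  show ?case
  proof (cases "sum w F = 0")
    case True
    \<comment> \<open>A massless set cannot be normalised, but discarding all of it is free; this
      also covers the empty set.\<close>
    then show ?thesis
      using \<open>0 \<le> S\<close> by (intro exI[of _ "\<lambda>x. {x}"] exI[of _ F]) auto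
  next
    case False
    then have "0 < sum w F" using sum_nonneg[of F w] w by simp
    then obtain E where E: "E \<subseteq> F" "E \<noteq> {}" "\<And>x y. \<lbrakk>x \<in> E; y \<in> E\<rbrakk> \<Longrightarrow> dist x y \<le> S"
      and bd: "sum w {y\<in>F - E. \<exists>x\<in>E. dist x y \<le> R} \<le> \<epsilon> * sum w E"
      using step[OF psubset(1) psubset.prems] by blast
    define D where "D = {y\<in>F - E. \<exists>x\<in>E. dist x y \<le> R}"
    define G where "G = F - E - D"
    have F: "F = E \<union> D \<union> G" "E \<inter> D = {}" "E \<inter> G = {}" "D \<inter> G = {}"
      using E by (auto simp: D_def G_def)
    have fin: "finite E" "finite D" "finite G"
      using psubset(1) F by (auto intro: finite_subset)
    have "G \<subset> F" "G \<subseteq> X" using E F psubset.prems by auto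
    from psubset.IH[OF this] obtain L :: "'a \<Rightarrow> 'a set" and B where LB: "B \<subseteq> G \<and> sum w B \<le> \<epsilon> * sum w G \<and>
        (\<forall>x\<in>G. x \<in> L x \<and> L x \<subseteq> G) \<and>
        (\<forall>x\<in>G. \<forall>y\<in>G. L x = L y \<longrightarrow> dist x y \<le> S) \<and>
        (\<forall>x\<in>G - B. \<forall>y\<in>G - B. dist x y \<le> R \<longrightarrow> L x = L y)"
      by (elim exE)
    then have B: "B \<subseteq> G" "sum w B \<le> \<epsilon> * sum w G"
      and L: "x \<in> G \<Longrightarrow> x \<in> L x" "x \<in> G \<Longrightarrow> L x \<subseteq> G"
        "\<lbrakk>x \<in> G; y \<in> G; L x = L y\<rbrakk> \<Longrightarrow> dist x y \<le> S"
        "\<lbrakk>x \<in> G - B; y \<in> G - B; dist x y \<le> R\<rbrakk> \<Longrightarrow> L x = L y" for x y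
      by blast+
    define L' where "L' x = (if x \<in> E then E else if x \<in> D then {x} else L x)" for x
    have L'E: "x \<in> E \<Longrightarrow> L' x = E" and L'D: "x \<in> D \<Longrightarrow> L' x = {x}" and L'G: "x \<in> G \<Longrightarrow> L' x = L x" for x
      using F by (auto simp: L'_def)
    have 1: "x \<in> L' x \<and> L' x \<subseteq> F" if "x \<in> F" for x
      using that F L(1,2)[of x] by (auto simp: L'_def)
    have 2: "dist x y \<le> S" if "x \<in> F" "y \<in> F" and eq: "L' x = L' y" for x y
    proof -
      have xy: "x \<in> L' y" "y \<in> L' x" using 1 that by auto
      consider "x \<in> E" | "x \<in> D" | "x \<in> G" using \<open>x \<in> F\<close> F by auto
      then show ?thesis
      proof cases
        case 1 then show ?thesis using xy E(3) by (simp add: L'E)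
      next
        case 2 then show ?thesis using xy \<open>0 \<le> S\<close> by (simp add: L'D)
      next
        case 3
        then have "y \<in> G" using xy(2) L(2)[of x] L'G by auto
        then show ?thesis using 3 eq L(3) L'G by auto
      qed
    qed
    \<comment> \<open>A point of \<open>F\<close> within \<open>R\<close> of \<open>E\<close> lies
      in \<open>E\<close> or in \<open>D\<close>.\<close>
    have mid: "L' x = L' y" if "x \<in> E" "y \<in> F - (D \<union> B)" "dist x y \<le> R" for x y
      using that E(1) by (auto simp: L'E D_def)
    have 3: "L' x = L' y" if x: "x \<in> F - (D \<union> B)" and y: "y \<in> F - (D \<union> B)" and d: "dist x y \<le> R" for x y
    proof -
      consider "x \<in> E" | "y \<in> E" | "x \<in> G - B" "y \<in> G - B" using x y F by auto
      then show ?thesis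
      proof cases
        case 1 then show ?thesis using mid y d by auto
      next
        case 2 then show ?thesis using mid[of y x] x d by (auto simp: dist_commute)
      next
        case 3 then show ?thesis using L(4)[of x y] d by (auto simp: L'G)
      qed
    qed
    have "sum w (D \<union> B) = sum w D + sum w B"
      using fin B F by (intro sum.union_disjoint) (auto intro: finite_subset)
    also have "\<dots> \<le> \<epsilon> * (sum w E + sum w G)"
      using bd B by (simp add: D_def algebra_simps)
    also have "\<dots> \<le> \<epsilon> * sum w F"
      using fin F w \<open>0 \<le> \<epsilon>\<close> by (intro mult_left_mono) (auto simp: sum.union_disjoint Int_Un_distrib2 sum_nonneg)
    finally have "sum w (D \<union> B) \<le> \<epsilon> * sum w F" .
    moreover have "D \<union> B \<subseteq> F" using F B by auto
    ultimately show ?thesis using 1 2 3 by (intro exI[of _ L'] exI[of _ "D \<union> B"]) blast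
  qed
qed

section \<open>Approachability: a minimax argument by repeated play\<close>

text \<open>The cross term carries \<open>max 0 a\<close> instead of \<open>a\<close>: replies exist
  only to nonnegative weights.\<close>

lemma positive_part_sq_add:
  fixes a b :: real
  shows "(max 0 (a + b))\<^sup>2 \<le> (max 0 a)\<^sup>2 + 2 * max 0 a * b + b\<^sup>2"
proof -
  have "\<bar>max 0 (a + b)\<bar> \<le> \<bar>max 0 a + b\<bar>" by (auto simp: max_def)
  then have "(max 0 (a + b))\<^sup>2 \<le> (max 0 a + b)\<^sup>2" by (simp only: abs_le_square_iff)
  then show ?thesis by (simp add: power2_sum algebra_simps)
qed

text \<open>Blackwell's strategy: replying to the positive part of the accumulated excess over \<open>\<epsilon>\<close> lets
  the sum of its squares grow by at most \<open>card Q\<close> per round, hence the excess itself only like the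
  square root of the number of rounds.\<close>

lemma approachability:
  fixes c :: "'p \<Rightarrow> 'q \<Rightarrow> real"
  assumes "finite Q" "0 < \<epsilon>"
    and c: "\<And>p q. p \<in> A \<Longrightarrow> q \<in> Q \<Longrightarrow> \<bar>c p q - \<epsilon>\<bar> \<le> 1"
    and reply: "\<And>\<nu>. (\<And>q. 0 \<le> \<nu> q) \<Longrightarrow> \<exists>p\<in>A. (\<Sum>q\<in>Q. \<nu> q * c p q) \<le> \<epsilon> * sum \<nu> Q"
  shows "\<exists>T>0. \<exists>p :: nat \<Rightarrow> 'p. (\<forall>i<T. p i \<in> A) \<and>
    (\<forall>q\<in>Q. (\<Sum>i<T. c (p i) q) \<le> 2 * \<epsilon> * real T)"
proof -
  have play: "\<exists>p :: nat \<Rightarrow> 'p. (\<forall>i<t. p i \<in> A) \<and>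
    (\<Sum>q\<in>Q. (max 0 (\<Sum>i<t. c (p i) q - \<epsilon>))\<^sup>2) \<le> real t * real (card Q)" for t
  proof (induction t)
    case 0
    then show ?case by simp
  next
    case (Suc t)
    then obtain p where p: "\<And>i. i < t \<Longrightarrow> p i \<in> A"
      "(\<Sum>q\<in>Q. (max 0 (\<Sum>i<t. c (p i) q - \<epsilon>))\<^sup>2) \<le> real t * real (card Q)" by auto
    define \<nu> where "\<nu> q = max 0 (\<Sum>i<t. c (p i) q - \<epsilon>)" for q
    obtain a where a: "a \<in> A" "(\<Sum>q\<in>Q. \<nu> q * c a q) \<le> \<epsilon> * sum \<nu> Q"
      using reply[of \<nu>] by (auto simp: \<nu>_def)
    have "(\<Sum>q\<in>Q. (max 0 (\<Sum>i<Suc t. c ((p(t := a)) i) q - \<epsilon>))\<^sup>2)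
      = (\<Sum>q\<in>Q. (max 0 ((\<Sum>i<t. c (p i) q - \<epsilon>) + (c a q - \<epsilon>)))\<^sup>2)"
      by simp
    also have "\<dots> \<le> (\<Sum>q\<in>Q. (\<nu> q)\<^sup>2 + 2 * (\<nu> q * (c a q - \<epsilon>)) + 1)"
    proof (rule sum_mono)
      fix q assume "q \<in> Q"
      then have "(c a q - \<epsilon>)\<^sup>2 \<le> 1" using c[OF a(1)] by (simp add: abs_square_le_1)
      then show "(max 0 ((\<Sum>i<t. c (p i) q - \<epsilon>) + (c a q - \<epsilon>)))\<^sup>2
          \<le> (\<nu> q)\<^sup>2 + 2 * (\<nu> q * (c a q - \<epsilon>)) + 1"
        using positive_part_sq_add[of "\<Sum>i<t. c (p i) q - \<epsilon>" "c a q - \<epsilon>"] unfolding \<nu>_def by linarith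
    qed
    \<comment> \<open>The cross terms add up to twice a quantity that the reply \<open>a\<close>
      makes nonpositive.\<close>
    also have "\<dots> = (\<Sum>q\<in>Q. (\<nu> q)\<^sup>2) + 2 * ((\<Sum>q\<in>Q. \<nu> q * c a q) - \<epsilon> * sum \<nu> Q) + real (card Q)"
      by (simp add: sum.distrib sum_subtractf sum_distrib_left[symmetric] right_diff_distrib
          sum_distrib_right[symmetric] mult.commute)
    also have "\<dots> \<le> real (Suc t) * real (card Q)"
      using a(2) p(2) by (simp add: \<nu>_def algebra_simps)
    finally show ?case
      using p(1) a(1) by (intro exI[of _ "p(t := a)"]) (auto simp: less_Suc_eq)
  qed
  \<comment> \<open>Since \<open>T * \<epsilon>\<^sup>2\<close> exceeds \<open>card Q\<close>, the
    accumulated excess is at most \<open>\<epsilon> * T\<close>; the baseline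
    \<open>\<epsilon> * T\<close> is the other half of the bound.\<close>
  obtain T where T: "real (card Q) / \<epsilon>\<^sup>2 < real T" using reals_Archimedean2 by blast
  then have "0 < T" using \<open>0 < \<epsilon>\<close> by (metis divide_nonneg_nonneg less_le_trans not_gr_zero of_nat_0 of_nat_0_le_iff zero_le_power2 linorder_not_le)
  obtain p where p: "\<And>i. i < T \<Longrightarrow> p i \<in> A"
    and le: "(\<Sum>q\<in>Q. (max 0 (\<Sum>i<T. c (p i) q - \<epsilon>))\<^sup>2) \<le> real T * real (card Q)"
    using play[of T] by auto
  have "(\<Sum>i<T. c (p i) q) \<le> 2 * \<epsilon> * real T" if "q \<in> Q" for q
  proof -
    let ?z = "\<Sum>i<T. c (p i) q - \<epsilon>"
    have "(max 0 ?z)\<^sup>2 \<le> (\<Sum>q\<in>Q. (max 0 (\<Sum>i<T. c (p i) q - \<epsilon>))\<^sup>2)"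
      using \<open>finite Q\<close> that by (intro member_le_sum[of q Q "\<lambda>q. (max 0 (\<Sum>i<T. c (p i) q - \<epsilon>))\<^sup>2"]) auto
    also have "\<dots> \<le> real T * real (card Q)" by (rule le)
    also have "\<dots> \<le> real T * (real T * \<epsilon>\<^sup>2)"
      using T \<open>0 < \<epsilon>\<close> by (intro mult_left_mono) (auto simp: field_simps)
    also have "\<dots> = (\<epsilon> * real T)\<^sup>2" by (simp add: power2_eq_square)
    finally have "max 0 ?z \<le> \<epsilon> * real T"
      by (rule power2_le_imp_le) (use \<open>0 < \<epsilon>\<close> in simp)
    then show ?thesis by (simp add: sum_subtractf algebra_simps)
  qed
  then show ?thesis using p \<open>0 < T\<close> by blast
qed

text \<open>The random partition is a uniform choice among \<open>L 0\<close>, ...,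
  \<open>L (T - 1)\<close>; \<open>T\<close> may depend on \<open>F\<close>, but \<open>S\<close>
  does not. Weights on close pairs are answered by \<open>sparse_partition\<close>, and
  \<open>approachability\<close> turns these replies into a bound for every single pair.\<close>

lemma random_partitions:
  fixes X :: "'a::metric_space set"
  assumes "ULA_mu X" "R > 0" "\<epsilon> > 0"
  shows "\<exists>S. \<forall>F. finite F \<longrightarrow> F \<subseteq> X \<longrightarrow> (\<exists>T>0. \<exists>L :: nat \<Rightarrow> 'a \<Rightarrow> 'a set. \<forall>x\<in>F. \<forall>y\<in>F.
      (\<forall>i<T. L i x = L i y \<longrightarrow> dist x y \<le> S) \<and>
      (dist x y \<le> R \<longrightarrow> (\<Sum>i<T. of_bool (L i x \<noteq> L i y)) \<le> \<epsilon> * real T))"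
proof -
  \<comment> \<open>Halving absorbs the factor 2 of \<open>approachability\<close>; the cap at 1
    keeps the payoffs within 1 of \<open>\<delta>\<close>.\<close>
  define \<delta> where "\<delta> = min (\<epsilon> / 2) 1"
  have \<delta>: "0 < \<delta>" "\<delta> \<le> 1" "2 * \<delta> \<le> \<epsilon>" using \<open>\<epsilon> > 0\<close> by (auto simp: \<delta>_def)
  \<comment> \<open>The further factor 1/2 pays for counting both endpoints of each pair in
    \<open>sum w F\<close>.\<close>
  obtain S where S: "S > 0" and ula: "\<And>F w. \<lbrakk>finite F; F \<subseteq> X; \<And>x. 0 \<le> w x; 0 < sum w F\<rbrakk> \<Longrightarrow>
       \<exists>E\<subseteq>F. E \<noteq> {} \<and> (\<forall>x\<in>E. \<forall>y\<in>E. dist x y \<le> S) \<and>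
         sum w {y\<in>F - E. \<exists>x\<in>E. dist x y \<le> R} \<le> (\<delta> / 2) * sum w E"
    by (rule ULA_mu_finite[OF assms(1,2), of "\<delta> / 2"]) (use \<delta> in auto)
  show ?thesis
  proof (intro exI[of _ S] allI impI)
    fix F assume F: "finite F" "F \<subseteq> X"
    define Q where "Q = {q\<in>F \<times> F. dist (fst q) (snd q) \<le> R}"
    define A where "A = {L :: 'a \<Rightarrow> 'a set. \<forall>x\<in>F. \<forall>y\<in>F. L x = L y \<longrightarrow> dist x y \<le> S}"
    define c where "c L q = (of_bool (L (fst q) \<noteq> L (snd q)) :: real)" for L :: "'a \<Rightarrow> 'a set" and q
    have Q: "finite Q" using F by (simp add: Q_def)
    have "\<exists>T>0. \<exists>L :: nat \<Rightarrow> 'a \<Rightarrow> 'a set. (\<forall>i<T. L i \<in> A) \<and>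
      (\<forall>q\<in>Q. (\<Sum>i<T. c (L i) q) \<le> 2 * \<delta> * real T)"
    proof (rule approachability[OF Q \<delta>(1)])
      show "\<bar>c p q - \<delta>\<bar> \<le> 1" for p q using \<delta> by (auto simp: c_def)
      fix \<nu> :: "'a \<times> 'a \<Rightarrow> real" assume \<nu>: "\<And>q. 0 \<le> \<nu> q"
      \<comment> \<open>The weighted degree; a diagonal pair counts twice at its point, so the total
        is exactly \<open>2 * sum \<nu> Q\<close>.\<close>
      define w where "w x = (\<Sum>q\<in>Q. \<nu> q * (of_bool (fst q = x) + of_bool (snd q = x)))" for x
      have w: "0 \<le> w x" for x unfolding w_def by (intro sum_nonneg mult_nonneg_nonneg \<nu>) auto
      have sum_w: "sum w B = (\<Sum>q\<in>Q. \<nu> q * (of_bool (fst q \<in> B) + of_bool (snd q \<in> B)))" if "finite B" for B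
      proof -
        have "sum w B = (\<Sum>q\<in>Q. \<nu> q * (\<Sum>x\<in>B. of_bool (fst q = x) + of_bool (snd q = x)))"
          unfolding w_def by (subst sum.swap) (simp add: sum_distrib_left)
        also have "\<dots> = (\<Sum>q\<in>Q. \<nu> q * (of_bool (fst q \<in> B) + of_bool (snd q \<in> B)))"
          using that by (simp add: sum.distrib of_bool_def)
        finally show ?thesis .
      qed
      have "\<exists>(L :: 'a \<Rightarrow> 'a set) B. B \<subseteq> F \<and> sum w B \<le> (\<delta> / 2) * sum w F \<and>
          (\<forall>x\<in>F. x \<in> L x \<and> L x \<subseteq> F) \<and>
          (\<forall>x\<in>F. \<forall>y\<in>F. L x = L y \<longrightarrow> dist x y \<le> S) \<and>
          (\<forall>x\<in>F - B. \<forall>y\<in>F - B. dist x y \<le> R \<longrightarrow> L x = L y)"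
        by (rule sparse_partition[of X w S R "\<delta> / 2" F, OF ula[OF _ _ w]]) (use w S \<delta> F in auto)
      then obtain L :: "'a \<Rightarrow> 'a set" and B where B: "B \<subseteq> F" "sum w B \<le> (\<delta> / 2) * sum w F"
        and L: "L \<in> A" "\<And>x y. \<lbrakk>x \<in> F - B; y \<in> F - B; dist x y \<le> R\<rbrakk> \<Longrightarrow> L x = L y"
        unfolding A_def by blast
      \<comment> \<open>A close pair with distinct labels has an endpoint in
        \<open>B\<close>.\<close>
      have "(\<Sum>q\<in>Q. \<nu> q * c L q) \<le> sum w B"
        unfolding sum_w[OF finite_subset[OF B(1) F(1)]]
      proof (intro sum_mono mult_left_mono \<nu>)
        fix q assume "q \<in> Q"
        then show "c L q \<le> of_bool (fst q \<in> B) + of_bool (snd q \<in> B)"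
          using L(2)[of "fst q" "snd q"] by (auto simp: c_def Q_def)
      qed
      also have "\<dots> \<le> (\<delta> / 2) * sum w F" by (rule B)
      also have "sum w F = 2 * sum \<nu> Q"
        unfolding sum_w[OF F(1)] sum_distrib_left by (intro sum.cong) (auto simp: Q_def)
      finally show "\<exists>L\<in>A. (\<Sum>q\<in>Q. \<nu> q * c L q) \<le> \<delta> * sum \<nu> Q" using L(1) by auto
    qed
    then obtain T and L :: "nat \<Rightarrow> 'a \<Rightarrow> 'a set" where T: "T > 0" and LA: "\<And>i. i < T \<Longrightarrow> L i \<in> A"
      and le: "\<And>q. q \<in> Q \<Longrightarrow> (\<Sum>i<T. c (L i) q) \<le> 2 * \<delta> * real T" by auto
    have "(\<Sum>i<T. of_bool (L i x \<noteq> L i y)) \<le> \<epsilon> * real T" if "x \<in> F" "y \<in> F" "dist x y \<le> R" for x y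
    proof -
      have "(\<Sum>i<T. of_bool (L i x \<noteq> L i y)) \<le> 2 * \<delta> * real T"
        using le[of "(x, y)"] that by (simp add: Q_def c_def)
      also have "\<dots> \<le> \<epsilon> * real T" using \<delta> by (intro mult_right_mono) auto
      finally show ?thesis .
    qed
    then show "\<exists>T>0. \<exists>L :: nat \<Rightarrow> 'a \<Rightarrow> 'a set. \<forall>x\<in>F. \<forall>y\<in>F.
      (\<forall>i<T. L i x = L i y \<longrightarrow> dist x y \<le> S) \<and>
      (dist x y \<le> R \<longrightarrow> (\<Sum>i<T. of_bool (L i x \<noteq> L i y)) \<le> \<epsilon> * real T)"
      using T LA unfolding A_def by blast
  qed
qed


section \<open>Kernels of negative type\<close>

text \<open>By Schoenberg's theorem these are, for countable \<open>A\<close>, the symmetric kernels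
  of conditionally negative type that vanish on the diagonal; the realisation by squared distances
  is taken as the definition.\<close>

definition neg_type_on :: "'a set \<Rightarrow> ('a \<Rightarrow> 'a \<Rightarrow> real) \<Rightarrow> bool" where
  "neg_type_on A \<psi> \<longleftrightarrow> (\<exists>f :: 'a \<Rightarrow> ell2. \<forall>x\<in>A. \<forall>y\<in>A. (dist (f x) (f y))\<^sup>2 = \<psi> x y)"

lemma dist_power2_inner:
  fixes x y :: "'b::real_inner"
  shows "(dist x y)\<^sup>2 = x \<bullet> x - 2 * (x \<bullet> y) + y \<bullet> y"
  by (simp add: dist_norm power2_norm_eq_inner inner_diff inner_commute)

text \<open>Gram-Schmidt along an enumeration of \<open>A\<close> moves the realisation into
  \<open>ell2\<close>, so products and the reals may serve as targets below.\<close>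

lemma neg_type_onI:
  fixes f :: "'a \<Rightarrow> 'h::real_inner"
  assumes "countable A" and \<psi>: "\<And>x y. x \<in> A \<Longrightarrow> y \<in> A \<Longrightarrow> (dist (f x) (f y))\<^sup>2 = \<psi> x y"
  shows "neg_type_on A \<psi>"
proof -
  obtain w :: "nat \<Rightarrow> ell2" where w: "\<And>m n. w m \<bullet> w n = f (from_nat_into A m) \<bullet> f (from_nat_into A n)"
    using exists_ell2_same_inner[of "\<lambda>n. f (from_nat_into A n)"] by auto
  have "(dist (w (to_nat_on A x)) (w (to_nat_on A y)))\<^sup>2 = \<psi> x y" if "x \<in> A" "y \<in> A" for x y
    using that \<open>countable A\<close> by (simp add: dist_power2_inner w \<psi>[symmetric])
  then show ?thesis unfolding neg_type_on_def by (intro exI[of _ "\<lambda>x. w (to_nat_on A x)"]) simp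
qed

text \<open>Squared distances add in an orthogonal direct sum.\<close>

lemma neg_type_on_add:
  assumes "countable A" "neg_type_on A \<phi>" "neg_type_on A \<psi>"
  shows "neg_type_on A (\<lambda>x y. \<phi> x y + \<psi> x y)"
proof -
  obtain f g :: "'a \<Rightarrow> ell2" where
    "\<forall>x\<in>A. \<forall>y\<in>A. \<phi> x y = (dist (f x) (f y))\<^sup>2" "\<forall>x\<in>A. \<forall>y\<in>A. \<psi> x y = (dist (g x) (g y))\<^sup>2"
    using assms unfolding neg_type_on_def by metis
  then show ?thesis
    by (intro neg_type_onI[OF assms(1), of "\<lambda>x. (f x, g x)"]) (simp add: dist_Pair_Pair)
qed

lemma neg_type_on_sum:
  assumes "countable A" "finite I" "\<And>i. i \<in> I \<Longrightarrow> neg_type_on A (\<psi> i)"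
  shows "neg_type_on A (\<lambda>x y. \<Sum>i\<in>I. \<psi> i x y)"
  using assms(2,3)
proof (induction I rule: finite_induct)
  case empty
  show ?case by (rule neg_type_onI[OF assms(1), of "\<lambda>_. 0::real"]) simp
next
  case (insert i I)
  then show ?case by (simp add: neg_type_on_add[OF assms(1)])
qed

lemma neg_type_on_scale:
  assumes "neg_type_on A \<psi>" "0 \<le> r"
  shows "neg_type_on A (\<lambda>x y. r * \<psi> x y)"
proof -
  obtain f :: "'a \<Rightarrow> ell2" where f: "\<forall>x\<in>A. \<forall>y\<in>A. (dist (f x) (f y))\<^sup>2 = \<psi> x y"
    using assms unfolding neg_type_on_def by auto
  have "(dist (sqrt r *\<^sub>R f x) (sqrt r *\<^sub>R f y))\<^sup>2 = r * (dist (f x) (f y))\<^sup>2" for x y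
    using \<open>0 \<le> r\<close> by (simp add: dist_norm power_mult_distrib flip: scaleR_diff_right)
  then show ?thesis
    using f unfolding neg_type_on_def by (intro exI[of _ "\<lambda>x. sqrt r *\<^sub>R f x"]) simp
qed

lemma neg_type_on_cong:
  assumes "neg_type_on A \<phi>" "\<And>x y. x \<in> A \<Longrightarrow> y \<in> A \<Longrightarrow> \<phi> x y = \<psi> x y"
  shows "neg_type_on A \<psi>"
  using assms unfolding neg_type_on_def by auto

text \<open>Points are sent to the indicators of their classes; points of different classes differ
  in exactly two coordinates, whence the factor 1/2.\<close>

lemma neg_type_on_partition:
  fixes L :: "'a \<Rightarrow> 'b"
  assumes "finite A"
  shows "neg_type_on A (\<lambda>x y. of_bool (L x \<noteq> L y))"
proof (rule neg_type_on_cong)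
  have "neg_type_on A (\<lambda>x y. (of_bool (L x = l) - of_bool (L y = l))\<^sup>2)" for l
    by (rule neg_type_onI[OF countable_finite[OF assms], of "\<lambda>x. of_bool (L x = l) :: real"])
      (simp add: dist_real_def)
  then show "neg_type_on A (\<lambda>x y. (1 / 2) * (\<Sum>l\<in>L ` A. (of_bool (L x = l) - of_bool (L y = l))\<^sup>2))"
    using assms by (intro neg_type_on_scale neg_type_on_sum) (auto intro: countable_finite)
  fix x y assume "x \<in> A" "y \<in> A"
  have "(of_bool (L x = l) - of_bool (L y = l) :: real)\<^sup>2
      = of_bool (L x \<noteq> L y) * (of_bool (L x = l) + of_bool (L y = l))" for l :: 'b
    by auto
  then have "(\<Sum>l\<in>L ` A. (of_bool (L x = l) - of_bool (L y = l) :: real)\<^sup>2)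
      = of_bool (L x \<noteq> L y) * ((\<Sum>l\<in>L ` A. of_bool (L x = l)) + (\<Sum>l\<in>L ` A. of_bool (L y = l)))"
    by (simp only: sum_distrib_left[symmetric] sum.distrib)
  also have "\<dots> = of_bool (L x \<noteq> L y) * 2"
    using \<open>x \<in> A\<close> \<open>y \<in> A\<close> assms by (simp add: of_bool_def)
  finally show "(1 / 2) * (\<Sum>l\<in>L ` A. (of_bool (L x = l) - of_bool (L y = l))\<^sup>2) = (of_bool (L x \<noteq> L y) :: real)"
    by simp
qed

section \<open>Compactness: from finite subsets to a countable set\<close>

text \<open>Triangular coordinates turn distances into sums of bounded length, which pass to pointwise
  limits; in general \<open>ell2\<close> norms are only lower semicontinuous under such limits.\<close>

lemma exists_ell2_triangular:
  fixes v :: "nat \<Rightarrow> 'h::real_inner"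
  shows "\<exists>w :: nat \<Rightarrow> ell2. (\<forall>m n. dist (w m) (w n) = dist (v m) (v n)) \<and> (\<forall>n. norm (w n) = norm (v n)) \<and>
    (\<forall>n. \<forall>l>n. coord (w n) l = 0)"
proof -
  define w where "w n = Abs_ell2 (\<lambda>l. v n \<bullet> gs v l)" for n
  have z: "v n \<bullet> gs v l = 0" if "n < l" for n l
  proof -
    obtain c where "v n = (\<Sum>k\<le>n. c k *\<^sub>R gs v k)" by (rule gs_expand)
    from gs_inner_expand[OF this, of l] that show ?thesis by simp
  qed
  have w: "coord (w n) = (\<lambda>l. v n \<bullet> gs v l)" for n
    unfolding w_def by (rule coord_Abs, rule summable_finite[of "{..n}"]) (auto simp: z)
  have inner: "w m \<bullet> w n = v m \<bullet> v n" for m n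
  proof -
    obtain c where c: "v n = (\<Sum>k\<le>n. c k *\<^sub>R gs v k)" by (rule gs_expand)
    have "w m \<bullet> w n = (\<Sum>l\<le>n. (v m \<bullet> gs v l) * (v n \<bullet> gs v l))"
      unfolding inner_ell2_def w by (rule suminf_finite) (auto simp: z)
    also have "\<dots> = (\<Sum>l\<le>n. c l * (v m \<bullet> gs v l))"
    proof (rule sum.cong)
      fix l assume "l \<in> {..n}"
      then show "(v m \<bullet> gs v l) * (v n \<bullet> gs v l) = c l * (v m \<bullet> gs v l)"
        using gs_inner_expand[OF c, of l] gs_idem[of "v m" v l] by (simp add: mult_ac)
    qed simp
    also have "\<dots> = v m \<bullet> v n" by (subst c) (simp add: inner_sum_right)
    finally show ?thesis .
  qed
  have "dist (w m) (w n) = dist (v m) (v n)" for m n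
    by (rule power2_eq_imp_eq) (simp_all add: dist_power2_inner inner)
  then show ?thesis
    by (intro exI[of _ w]) (auto simp: w z norm_eq_sqrt_inner inner)
qed

text \<open>By Tychonoff the product of the intervals is compact; over countably many indices it is
  first countable, so compactness yields convergent subsequences.\<close>

lemma pointwise_convergent_subsequence:
  fixes \<tau> :: "nat \<Rightarrow> 'i::countable \<Rightarrow> real"
  assumes "\<And>k i. \<bar>\<tau> k i\<bar> \<le> B i"
  shows "\<exists>t r. strict_mono r \<and> (\<forall>i. (\<lambda>k. \<tau> (r k) i) \<longlonglongrightarrow> t i)"
proof -
  have "compactin (product_topology (\<lambda>_. euclidean) UNIV) (PiE UNIV (\<lambda>i. cball (0::real) (B i)))"
    by (simp add: compactin_PiE)
  then have "seq_compact (PiE UNIV (\<lambda>i. cball (0::real) (B i)))"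
    by (simp add: euclidean_product_topology compact_imp_seq_compact)
  moreover have "\<tau> k \<in> PiE UNIV (\<lambda>i. cball 0 (B i))" for k using assms by (simp add: PiE_iff)
  ultimately obtain t r where r: "strict_mono r" and lim: "(\<tau> \<circ> r) \<longlonglongrightarrow> t"
    unfolding seq_compact_def by metis
  have "(\<lambda>k. \<tau> (r k) i) \<longlonglongrightarrow> t i" for i
    using continuous_on_tendsto_compose[OF continuous_on_product_coordinates lim, of i] by simp
  with r show ?thesis by blast
qed

text \<open>Embeddings of an exhaustion by finite sets are translated to send \<open>e 0\<close> to
  the origin and put into triangular coordinates. Each coordinate is then bounded independently of
  the stage, so a subsequence converges coordinatewise. The squared distance of two given points
  eventually is a sum of a fixed number of terms, so it converges and both bounds survive.\<close>

lemma ell2_embedding_from_finite_subsets: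
  fixes X :: "'a set" and lo hi :: "'a \<Rightarrow> 'a \<Rightarrow> real"
  assumes "countable X"
    and fin: "\<And>F. finite F \<Longrightarrow> F \<subseteq> X \<Longrightarrow> \<exists>f :: 'a \<Rightarrow> ell2. \<forall>x\<in>F. \<forall>y\<in>F.
      lo x y \<le> (dist (f x) (f y))\<^sup>2 \<and> (dist (f x) (f y))\<^sup>2 \<le> hi x y"
  shows "\<exists>f :: 'a \<Rightarrow> ell2. \<forall>x\<in>X. \<forall>y\<in>X.
      lo x y \<le> (dist (f x) (f y))\<^sup>2 \<and> (dist (f x) (f y))\<^sup>2 \<le> hi x y"
proof (cases "X = {}")
  case False
  define e where "e = from_nat_into X"
  have e: "e n \<in> X" for n unfolding e_def by (rule from_nat_into[OF False])
  have "\<forall>N. \<exists>f :: 'a \<Rightarrow> ell2. \<forall>x\<in>e ` {..N}. \<forall>y\<in>e ` {..N}.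
      lo x y \<le> (dist (f x) (f y))\<^sup>2 \<and> (dist (f x) (f y))\<^sup>2 \<le> hi x y"
    using e by (intro allI fin) auto
  from choice[OF this] obtain f :: "nat \<Rightarrow> 'a \<Rightarrow> ell2" where
    "\<forall>N. \<forall>x\<in>e ` {..N}. \<forall>y\<in>e ` {..N}.
      lo x y \<le> (dist (f N x) (f N y))\<^sup>2 \<and> (dist (f N x) (f N y))\<^sup>2 \<le> hi x y" by blast
  then have f: "\<lbrakk>m \<le> N; n \<le> N\<rbrakk> \<Longrightarrow> lo (e m) (e n) \<le> (dist (f N (e m)) (f N (e n)))\<^sup>2"
       "\<lbrakk>m \<le> N; n \<le> N\<rbrakk> \<Longrightarrow> (dist (f N (e m)) (f N (e n)))\<^sup>2 \<le> hi (e m) (e n)" for N m n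
    by auto
  have "\<forall>N. \<exists>w :: nat \<Rightarrow> ell2. (\<forall>m n. dist (w m) (w n) = dist (f N (e m)) (f N (e n))) \<and>
      (\<forall>n. norm (w n) = dist (f N (e n)) (f N (e 0))) \<and> (\<forall>n. \<forall>l>n. coord (w n) l = 0)"
  proof
    fix N
    show "\<exists>w :: nat \<Rightarrow> ell2. (\<forall>m n. dist (w m) (w n) = dist (f N (e m)) (f N (e n))) \<and>
      (\<forall>n. norm (w n) = dist (f N (e n)) (f N (e 0))) \<and> (\<forall>n. \<forall>l>n. coord (w n) l = 0)"
      using exists_ell2_triangular[of "\<lambda>n. f N (e n) - f N (e 0)"] by (simp add: dist_norm)
  qed
  from choice[OF this] obtain w :: "nat \<Rightarrow> nat \<Rightarrow> ell2" where
    w: "\<And>N m n. dist (w N m) (w N n) = dist (f N (e m)) (f N (e n))"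
       "\<And>N n. norm (w N n) = dist (f N (e n)) (f N (e 0))"
       "\<And>N n l. n < l \<Longrightarrow> coord (w N n) l = 0"
    by blast
  \<comment> \<open>Indices beyond the stage \<open>N\<close> get coordinates 0, so that the bound
    holds at all stages; for each \<open>n\<close> this affects finitely many stages.\<close>
  define \<tau> where "\<tau> N = (\<lambda>(n, l). if n \<le> N then coord (w N n) l else 0)" for N
  have bound: "\<bar>\<tau> N p\<bar> \<le> sqrt \<bar>hi (e (fst p)) (e 0)\<bar>" for N p
  proof (cases "fst p \<le> N")
    case True
    have "\<bar>\<tau> N p\<bar> \<le> norm (w N (fst p))"
      using True abs_coord_le_norm[of "w N (fst p)" "snd p"] by (simp add: \<tau>_def split_beta)
    also have "\<dots> \<le> sqrt \<bar>hi (e (fst p)) (e 0)\<bar>"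
      using f(2)[OF True, of 0] by (intro real_le_rsqrt) (simp add: w)
    finally show ?thesis .
  next
    case False
    then show ?thesis by (simp add: \<tau>_def split_beta)
  qed
  obtain t r where r: "strict_mono r" and t: "\<And>p. (\<lambda>k. \<tau> (r k) p) \<longlonglongrightarrow> t p"
    using pointwise_convergent_subsequence[of \<tau>, OF bound] by blast
  have t0: "t (n, l) = 0" if "n < l" for n l
  proof -
    have "\<tau> (r k) (n, l) = 0" for k using w(3)[OF that] by (simp add: \<tau>_def)
    then show ?thesis using LIMSEQ_unique[OF t[of "(n, l)"]] by simp
  qed
  define g where "g x = Abs_ell2 (\<lambda>l. t (to_nat_on X x, l))" for x
  have g: "coord (g x) = (\<lambda>l. t (to_nat_on X x, l))" for x
    unfolding g_def by (rule coord_Abs, rule summable_finite[of "{..to_nat_on X x}"]) (auto simp: t0)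
  have dist_sum: "(dist (u::ell2) v)\<^sup>2 = (\<Sum>l\<le>k. (coord u l - coord v l)\<^sup>2)"
    if "\<And>l. k < l \<Longrightarrow> coord u l = 0" "\<And>l. k < l \<Longrightarrow> coord v l = 0" for u v k
    unfolding dist_norm norm_ell2_power2 coord_minus by (rule suminf_finite) (use that in auto)
  have lim: "(\<lambda>k. (dist (f (r k) x) (f (r k) y))\<^sup>2) \<longlonglongrightarrow> (dist (g x) (g y))\<^sup>2"
    and lo: "\<forall>\<^sub>F k in sequentially. lo x y \<le> (dist (f (r k) x) (f (r k) y))\<^sup>2"
    and hi: "\<forall>\<^sub>F k in sequentially. (dist (f (r k) x) (f (r k) y))\<^sup>2 \<le> hi x y"
    if xy: "x \<in> X" "y \<in> X" for x y
  proof -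
    define m n where "m = to_nat_on X x" and "n = to_nat_on X y"
    have mn: "e m = x" "e n = y" using xy assms(1) by (simp_all add: m_def n_def e_def)
    have ev: "\<forall>\<^sub>F k in sequentially. m \<le> r k \<and> n \<le> r k"
      using seq_suble[OF r] by (intro eventually_sequentiallyI[of "max m n"]) (meson le_trans max.boundedE)
    show "\<forall>\<^sub>F k in sequentially. lo x y \<le> (dist (f (r k) x) (f (r k) y))\<^sup>2"
      using ev by eventually_elim (use f(1)[of m _ n] mn in auto)
    show "\<forall>\<^sub>F k in sequentially. (dist (f (r k) x) (f (r k) y))\<^sup>2 \<le> hi x y"
      using ev by eventually_elim (use f(2)[of m _ n] mn in auto)
    have "(\<lambda>k. \<Sum>l\<le>max m n. (\<tau> (r k) (m, l) - \<tau> (r k) (n, l))\<^sup>2)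
        \<longlonglongrightarrow> (\<Sum>l\<le>max m n. (t (m, l) - t (n, l))\<^sup>2)"
      by (intro tendsto_intros t)
    also have "(\<Sum>l\<le>max m n. (t (m, l) - t (n, l))\<^sup>2) = (dist (g x) (g y))\<^sup>2"
      by (subst dist_sum[of "max m n"]) (auto simp: g t0 m_def n_def)
    finally show "(\<lambda>k. (dist (f (r k) x) (f (r k) y))\<^sup>2) \<longlonglongrightarrow> (dist (g x) (g y))\<^sup>2"
    proof (rule Lim_transform_eventually)
      have eq: "(dist (f N x) (f N y))\<^sup>2 = (\<Sum>l\<le>max m n. (\<tau> N (m, l) - \<tau> N (n, l))\<^sup>2)" if "m \<le> N" "n \<le> N" for N
        using that w(1)[of N m n] dist_sum[of "max m n" "w N m" "w N n"]
        by (simp add: \<tau>_def mn w(3))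
      show "\<forall>\<^sub>F k in sequentially. (\<Sum>l\<le>max m n. (\<tau> (r k) (m, l) - \<tau> (r k) (n, l))\<^sup>2)
          = (dist (f (r k) x) (f (r k) y))\<^sup>2"
        using ev by eventually_elim (simp add: eq)
    qed
  qed
  show ?thesis
    using tendsto_lowerbound[OF lim lo] tendsto_upperbound[OF lim hi] by (intro exI[of _ g]) simp
qed simp


section \<open>The coarse embedding\<close>

text \<open>The kernel is the proportion of the partitions from \<open>random_partitions\<close>
  that separate the two points.\<close>

lemma truncated_kernel:
  fixes X :: "'a::metric_space set"
  assumes "ULA_mu X" "R > 0" "\<epsilon> > 0"
  shows "\<exists>S. \<forall>F. finite F \<longrightarrow> F \<subseteq> X \<longrightarrow> (\<exists>\<psi>. neg_type_on F \<psi> \<and> (\<forall>x\<in>F. \<forall>y\<in>F.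
      0 \<le> \<psi> x y \<and> \<psi> x y \<le> 1 \<and> (dist x y \<le> R \<longrightarrow> \<psi> x y \<le> \<epsilon>) \<and> (S < dist x y \<longrightarrow> \<psi> x y = 1)))"
proof -
  obtain S where S: "\<forall>F. finite F \<longrightarrow> F \<subseteq> X \<longrightarrow> (\<exists>T>0. \<exists>L :: nat \<Rightarrow> 'a \<Rightarrow> 'a set. \<forall>x\<in>F. \<forall>y\<in>F.
      (\<forall>i<T. L i x = L i y \<longrightarrow> dist x y \<le> S) \<and>
      (dist x y \<le> R \<longrightarrow> (\<Sum>i<T. of_bool (L i x \<noteq> L i y)) \<le> \<epsilon> * real T))"
    using random_partitions[OF assms] by (elim exE)
  show ?thesis
  proof (intro exI[of _ S] allI impI)
    fix F assume F: "finite F" "F \<subseteq> X"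
    from S[rule_format, OF F] obtain T and L :: "nat \<Rightarrow> 'a \<Rightarrow> 'a set" where T: "T > 0"
      and "\<forall>x\<in>F. \<forall>y\<in>F. (\<forall>i<T. L i x = L i y \<longrightarrow> dist x y \<le> S) \<and>
      (dist x y \<le> R \<longrightarrow> (\<Sum>i<T. of_bool (L i x \<noteq> L i y)) \<le> \<epsilon> * real T)"
      by (elim exE conjE)
    then have L: "\<And>x y i. \<lbrakk>x \<in> F; y \<in> F; i < T; L i x = L i y\<rbrakk> \<Longrightarrow> dist x y \<le> S"
        "\<And>x y. \<lbrakk>x \<in> F; y \<in> F; dist x y \<le> R\<rbrakk> \<Longrightarrow> (\<Sum>i<T. of_bool (L i x \<noteq> L i y)) \<le> \<epsilon> * real T"
      by blast+
    define \<psi> where "\<psi> x y = (1 / real T) * (\<Sum>i<T. of_bool (L i x \<noteq> L i y))" for x y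
    have "neg_type_on F \<psi>"
      unfolding \<psi>_def using F
      by (intro neg_type_on_scale neg_type_on_sum neg_type_on_partition countable_finite) auto
    moreover have "0 \<le> \<psi> x y \<and> \<psi> x y \<le> 1" for x y
      using T sum_bounded_above[of "{..<T}" "\<lambda>i. of_bool (L i x \<noteq> L i y)" "1::real"]
      by (auto simp: \<psi>_def sum_nonneg field_simps)
    moreover have "\<psi> x y \<le> \<epsilon>" if "x \<in> F" "y \<in> F" "dist x y \<le> R" for x y
      using L(2)[OF that] T by (simp add: \<psi>_def field_simps)
    moreover have "\<psi> x y = 1" if "x \<in> F" "y \<in> F" "S < dist x y" for x y
    proof -
      have "(\<Sum>i<T. of_bool (L i x \<noteq> L i y)) = (\<Sum>i<T. 1::real)"
        using L(1)[of x y] that by (intro sum.cong) (auto simp: not_le[symmetric])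
      then show ?thesis using T by (simp add: \<psi>_def)
    qed
    ultimately show "\<exists>\<psi>. neg_type_on F \<psi> \<and> (\<forall>x\<in>F. \<forall>y\<in>F.
      0 \<le> \<psi> x y \<and> \<psi> x y \<le> 1 \<and> (dist x y \<le> R \<longrightarrow> \<psi> x y \<le> \<epsilon>) \<and> (S < dist x y \<longrightarrow> \<psi> x y = 1))"
      by (intro exI[of _ \<psi>]) blast
  qed
qed

text \<open>Counts the scales at which \<open>finite_subset_embedding\<close> has only the trivial
  bound 1 on the kernel.\<close>

lemma card_shifted_less_le:
  fixes d :: real
  assumes "0 \<le> d"
  shows "real (card {n. real n + 1 < d}) \<le> d"
proof -
  have "{n. real n + 1 < d} \<subseteq> {..<nat \<lfloor>d\<rfloor>}" by (auto simp: less_floor_iff zless_nat_eq_int_zless)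
  then have "card {n. real n + 1 < d} \<le> nat \<lfloor>d\<rfloor>" using card_mono[of "{..<nat \<lfloor>d\<rfloor>}"] by simp
  then show ?thesis using assms by linarith
qed

text \<open>Scale \<open>n\<close> contributes a truncated kernel with \<open>R = n + 1\<close> and
  \<open>\<epsilon> = (1 / 2) ^ n\<close>. A pair gains 1 from each scale with \<open>S n\<close>
  below its distance. From above, each scale with \<open>n + 1\<close> below the distance adds at
  most 1, and the others are dominated by a geometric series of sum 2.\<close>

lemma finite_subset_embedding:
  fixes X :: "'a::metric_space set"
  assumes "ULA_mu X"
  shows "\<exists>S :: nat \<Rightarrow> real. (\<forall>n. real n \<le> S n) \<and> (\<forall>F. finite F \<longrightarrow> F \<subseteq> X \<longrightarrow> (\<exists>f :: 'a \<Rightarrow> ell2. \<forall>x\<in>F. \<forall>y\<in>F.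
      real (card {n. S n < dist x y}) \<le> (dist (f x) (f y))\<^sup>2 \<and> (dist (f x) (f y))\<^sup>2 \<le> dist x y + 2))"
proof -
  have "\<forall>n. \<exists>S. \<forall>F. finite F \<longrightarrow> F \<subseteq> X \<longrightarrow> (\<exists>\<psi>. neg_type_on F \<psi> \<and> (\<forall>x\<in>F. \<forall>y\<in>F.
      0 \<le> \<psi> x y \<and> \<psi> x y \<le> 1 \<and> (dist x y \<le> real n + 1 \<longrightarrow> \<psi> x y \<le> (1 / 2) ^ n) \<and> (S < dist x y \<longrightarrow> \<psi> x y = 1)))"
    by (intro allI truncated_kernel[OF assms]) auto
  from choice[OF this] obtain S where S: "\<forall>n F. finite F \<longrightarrow> F \<subseteq> X \<longrightarrow> (\<exists>\<psi>. neg_type_on F \<psi> \<and> (\<forall>x\<in>F. \<forall>y\<in>F.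
      0 \<le> \<psi> x y \<and> \<psi> x y \<le> 1 \<and> (dist x y \<le> real n + 1 \<longrightarrow> \<psi> x y \<le> (1 / 2) ^ n) \<and> (S n < dist x y \<longrightarrow> \<psi> x y = 1)))"
    by (elim exE)
  \<comment> \<open>Raising \<open>S n\<close> to at least \<open>n\<close> leaves finitely many
    scales below any distance; \<open>card\<close> of an infinite set would be 0.\<close>
  define S' where "S' n = max (S n) (real n)" for n
  show ?thesis
  proof (intro exI[of _ S'] conjI allI impI)
    show "real n \<le> S' n" for n by (simp add: S'_def)
    fix F assume F: "finite F" "F \<subseteq> X"
    then have "\<forall>n. \<exists>\<psi>. neg_type_on F \<psi> \<and> (\<forall>x\<in>F. \<forall>y\<in>F.
      0 \<le> \<psi> x y \<and> \<psi> x y \<le> 1 \<and> (dist x y \<le> real n + 1 \<longrightarrow> \<psi> x y \<le> (1 / 2) ^ n) \<and> (S n < dist x y \<longrightarrow> \<psi> x y = 1))"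
      using S by simp
    from choice[OF this] obtain \<psi> where \<psi>: "\<forall>n. neg_type_on F (\<psi> n) \<and> (\<forall>x\<in>F. \<forall>y\<in>F.
      0 \<le> \<psi> n x y \<and> \<psi> n x y \<le> 1 \<and> (dist x y \<le> real n + 1 \<longrightarrow> \<psi> n x y \<le> (1 / 2) ^ n) \<and> (S n < dist x y \<longrightarrow> \<psi> n x y = 1))"
      by (elim exE)
    \<comment> \<open>\<open>M\<close> bounds the distances in \<open>F\<close>, so all scales
      counted in either bound are below \<open>M\<close> and a finite sum of kernels
      suffices.\<close>
    obtain M where "diameter F \<le> real M" using real_arch_simple by blast
    then have M: "dist x y \<le> real M" if "x \<in> F" "y \<in> F" for x y
      using diameter_bounded_bound[OF finite_imp_bounded[OF F(1)] that] by simp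
    have "neg_type_on F (\<lambda>x y. \<Sum>n<M. \<psi> n x y)"
      using F \<psi> by (intro neg_type_on_sum countable_finite) auto
    then obtain f :: "'a \<Rightarrow> ell2" where f: "\<And>x y. \<lbrakk>x \<in> F; y \<in> F\<rbrakk> \<Longrightarrow> (dist (f x) (f y))\<^sup>2 = (\<Sum>n<M. \<psi> n x y)"
      unfolding neg_type_on_def by blast
    have "real (card {n. S' n < dist x y}) \<le> (\<Sum>n<M. \<psi> n x y) \<and> (\<Sum>n<M. \<psi> n x y) \<le> dist x y + 2"
      if xy: "x \<in> F" "y \<in> F" for x y
    proof
      have sub: "{n. S' n < dist x y} \<subseteq> {..<M}"
        using M[OF xy] by (auto simp: S'_def)
      have "real (card {n. S' n < dist x y}) = (\<Sum>n\<in>{n. S' n < dist x y}. \<psi> n x y)"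
        using \<psi> xy by (simp add: S'_def)
      also have "\<dots> \<le> (\<Sum>n<M. \<psi> n x y)"
        using \<psi> xy sub by (intro sum_mono2) auto
      finally show "real (card {n. S' n < dist x y}) \<le> (\<Sum>n<M. \<psi> n x y)" .
      have "(\<Sum>n<M. \<psi> n x y) \<le> (\<Sum>n<M. of_bool (real n + 1 < dist x y) + (1 / 2) ^ n)"
      proof (rule sum_mono)
        fix n
        show "\<psi> n x y \<le> of_bool (real n + 1 < dist x y) + (1 / 2) ^ n"
        proof (cases "real n + 1 < dist x y")
          case True
          have "\<psi> n x y \<le> 1" using \<psi> xy by blast
          moreover have "1 \<le> of_bool (real n + 1 < dist x y) + (1 / 2 :: real) ^ n" using True by simp
          ultimately show ?thesis by linarith
        next
          case False
          then show ?thesis using \<psi> xy by simp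
        qed
      qed
      also have "\<dots> = real (card ({..<M} \<inter> {n. real n + 1 < dist x y})) + (\<Sum>n<M. (1 / 2) ^ n)"
        by (simp add: sum.distrib sum.If_cases of_bool_def)
      also have "(\<Sum>n<M. (1 / 2 :: real) ^ n) \<le> 2"
        by (simp add: sum_gp_strict)
      also have "{..<M} \<inter> {n. real n + 1 < dist x y} = {n. real n + 1 < dist x y}"
        using M[OF xy] by auto
      finally show "(\<Sum>n<M. \<psi> n x y) \<le> dist x y + 2"
        using card_shifted_less_le[of "dist x y"] by simp
    qed
    with f show "\<exists>f :: 'a \<Rightarrow> ell2. \<forall>x\<in>F. \<forall>y\<in>F.
      real (card {n. S' n < dist x y}) \<le> (dist (f x) (f y))\<^sup>2 \<and> (dist (f x) (f y))\<^sup>2 \<le> dist x y + 2"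
      by (intro exI[of _ f]) simp
  qed
qed

text \<open>The bounds on finite subsets do not depend on the subset, so compactness extends them to
  \<open>X\<close>, whose countability comes from bounded geometry. Their square roots are the
  control functions.\<close>

theorem corollary3p5:
  fixes X :: "'a::metric_space set"
  assumes "bounded_geometry X" and "ULA_mu X"
  shows "\<exists>f :: 'a \<Rightarrow> ell2. coarse_embedding X f"
proof -
  obtain S :: "nat \<Rightarrow> real" where S: "\<And>n. real n \<le> S n"
    and fin: "\<forall>F. finite F \<longrightarrow> F \<subseteq> X \<longrightarrow> (\<exists>f :: 'a \<Rightarrow> ell2. \<forall>x\<in>F. \<forall>y\<in>F.
      real (card {n. S n < dist x y}) \<le> (dist (f x) (f y))\<^sup>2 \<and> (dist (f x) (f y))\<^sup>2 \<le> dist x y + 2)"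
    using finite_subset_embedding[OF assms(2)] by blast
  obtain f :: "'a \<Rightarrow> ell2" where f: "\<forall>x\<in>X. \<forall>y\<in>X.
      real (card {n. S n < dist x y}) \<le> (dist (f x) (f y))\<^sup>2 \<and> (dist (f x) (f y))\<^sup>2 \<le> dist x y + 2"
    using ell2_embedding_from_finite_subsets[OF bounded_geometry_countable[OF assms(1)] fin[rule_format]] by blast
  \<comment> \<open>Finiteness makes \<open>card\<close> monotone here; it follows from
    \<open>n \<le> S n\<close>.\<close>
  have finS: "finite {n. S n < t}" for t
  proof (rule finite_subset)
    show "{n. S n < t} \<subseteq> {..nat \<lceil>t\<rceil>}"
    proof
      fix n assume "n \<in> {n. S n < t}"
      then show "n \<in> {..nat \<lceil>t\<rceil>}" using S[of n] by (simp, linarith)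
    qed
  qed simp
  define \<rho>p where "\<rho>p t = sqrt (t + 2)" for t
  define \<rho>m where "\<rho>m t = sqrt (real (card {n. S n < t}))" for t
  have "mono_on {0..} \<rho>p" "mono_on {0..} \<rho>m"
    by (auto simp: mono_on_def \<rho>p_def \<rho>m_def intro!: card_mono finS)
  moreover have "\<rho>p ` {0..} \<subseteq> {0..}" "\<rho>m ` {0..} \<subseteq> {0..}"
    by (auto simp: \<rho>p_def \<rho>m_def)
  moreover have "filterlim \<rho>m at_top at_top"
    unfolding \<rho>m_def
  proof (intro filterlim_compose[OF sqrt_at_top] filterlim_compose[OF filterlim_real_sequentially])
    show "filterlim (\<lambda>t. card {n. S n < t}) at_top at_top"
      unfolding filterlim_at_top
    proof
      fix k
      \<comment> \<open>Once \<open>t\<close> exceeds \<open>S 0\<close>, ...,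
        \<open>S (k - 1)\<close>, at least \<open>k\<close> scales are counted.\<close>
      have "\<forall>\<^sub>F t in at_top. \<forall>n\<in>{..<k}. S n < t"
        by (intro eventually_ball_finite) (auto intro: eventually_gt_at_top)
      then show "\<forall>\<^sub>F t in at_top. k \<le> card {n. S n < t}"
      proof eventually_elim
        case (elim t)
        then have "card {..<k} \<le> card {n. S n < t}" by (intro card_mono finS) auto
        then show ?case by simp
      qed
    qed
  qed
  moreover have "\<rho>m (dist x y) \<le> dist (f x) (f y) \<and> dist (f x) (f y) \<le> \<rho>p (dist x y)"
    if "x \<in> X" "y \<in> X" for x y
    using f that by (auto simp: \<rho>m_def \<rho>p_def intro!: real_le_lsqrt real_le_rsqrt)
  ultimately show ?thesis
    unfolding coarse_embedding_def
    by (intro exI[of _ f] exI[of _ \<rho>p] exI[of _ \<rho>m] conjI ballI) simp_all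
qed

end
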